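(* Let $\alpha=\sqrt8$. Then there is a unique non-trivial increasing solution to the complementary pair problem: $(p,q,r,s,t,u)=(1,4,0,-1,4,0)$.
   Context: Two sequences $V=(V(n))_{n\ge1}$ and $W=(W(n))_{n\ge1}$ are complementary if the sets $\{V(n):n\ge1\}$ and $\{W(n):n\ge1\}$ are disjoint and their union is the set of positive integers. The complementary pair problem for an irrational number $\alpha$ asks for which sextuples of integers $(p,q,r,s,t,u)$ the sequences $V(n)=p\lfloor n\alpha\rfloor+qn+r$ and $W(n)=s\lfloor n\alpha\rfloor+tn+u$ ($n\ge1$) are complementary; such a sextuple is called a solution. Sequences are required to be injective as functions of $n$. A solution is trivial if $p=0$ or $s=0$, and it is increasing if $V$ and $W$ are increasing. In the increasing case it is also required, without loss of generality, that $V(1)=1$.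
   Formalization: The printed sextuple (1,4,0,-1,4,0) is not a solution: V(1)=W(5)=6, and 1 is never attained. The formal theorem instead states that the unique non-trivial increasing solution with V(1)=1 is (p,q,r,s,t,u)=(-1,4,-1,1,4,0). *)

theory Defs
  imports Complex_Main
begin

definition gen_beatty :: "real \<Rightarrow> int \<Rightarrow> int \<Rightarrow> int \<Rightarrow> nat \<Rightarrow> int" where
  "gen_beatty \<alpha> p q r n = p * \<lfloor>real n * \<alpha>\<rfloor> + q * int n + r"

(* Sequences are indexed by n >= 1; their values at 0 are irrelevant. *)
definition complementary :: "(nat \<Rightarrow> int) \<Rightarrow> (nat \<Rightarrow> int) \<Rightarrow> bool" where
  "complementary V W \<longleftrightarrow> V ` {1..} \<inter> W ` {1..} = {} \<and> V ` {1..} \<union> W ` {1..} = {k. 0 < k}"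

definition cpp_solution :: "real \<Rightarrow> int \<Rightarrow> int \<Rightarrow> int \<Rightarrow> int \<Rightarrow> int \<Rightarrow> int \<Rightarrow> bool" where
  "cpp_solution \<alpha> p q r s t u \<longleftrightarrow>
     inj_on (gen_beatty \<alpha> p q r) {1..} \<and> inj_on (gen_beatty \<alpha> s t u) {1..} \<and>
     complementary (gen_beatty \<alpha> p q r) (gen_beatty \<alpha> s t u)"

definition trivial_solution :: "real \<Rightarrow> int \<Rightarrow> int \<Rightarrow> int \<Rightarrow> int \<Rightarrow> int \<Rightarrow> int \<Rightarrow> bool" where
  "trivial_solution \<alpha> p q r s t u \<longleftrightarrow> cpp_solution \<alpha> p q r s t u \<and> (p = 0 \<or> s = 0)"

(* The last conjunct is the normalisation V(1) = 1: complementarity is symmetric in V and W,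
   and for increasing sequences one of V(1), W(1) has to be 1. *)
definition increasing_solution :: "real \<Rightarrow> int \<Rightarrow> int \<Rightarrow> int \<Rightarrow> int \<Rightarrow> int \<Rightarrow> int \<Rightarrow> bool" where
  "increasing_solution \<alpha> p q r s t u \<longleftrightarrow>
     cpp_solution \<alpha> p q r s t u \<and>
     strict_mono_on {1..} (gen_beatty \<alpha> p q r) \<and> strict_mono_on {1..} (gen_beatty \<alpha> s t u) \<and>
     gen_beatty \<alpha> p q r 1 = 1"

(* The sextuple (1,4,0,-1,4,0), sometimes given as the solution for sqrt 8, is not one:
   V = 6, 13, 20, ... and W = 2, 3, 4, 5, 6, 8, ... share the value 6 (and both miss 1).
   Replacing its last entry by -1 gives a complementary pair; naming the sequence that
   starts with 1 first, this pair is (-1,4,-1,1,4,0). *)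
lemma not_cpp_solution_sqrt8: "\<not> cpp_solution (sqrt 8) 1 4 0 (-1) 4 0"
proof
  assume "cpp_solution (sqrt 8) 1 4 0 (-1) 4 0"
  then have disj: "gen_beatty (sqrt 8) 1 4 0 ` {1..} \<inter> gen_beatty (sqrt 8) (-1) 4 0 ` {1..} = {}"
    by (simp add: cpp_solution_def complementary_def)
  have l: "14/5 < sqrt 8" by (rule real_less_rsqrt) (simp add: power2_eq_square)
  have u: "sqrt 8 < 29/10" by (rule real_less_lsqrt) (simp_all add: power2_eq_square)
  have "\<lfloor>sqrt 8\<rfloor> = 2" "\<lfloor>5 * sqrt 8\<rfloor> = 14"
    using l u by (auto simp: floor_eq_iff)
  then have "gen_beatty (sqrt 8) 1 4 0 1 = 6" "gen_beatty (sqrt 8) (-1) 4 0 5 = 6"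
    by (simp_all add: gen_beatty_def)
  then have "6 \<in> gen_beatty (sqrt 8) 1 4 0 ` {1..}" "6 \<in> gen_beatty (sqrt 8) (-1) 4 0 ` {1..}"
    by (metis atLeast_iff imageI le_refl, metis atLeast_iff imageI one_le_numeral)
  with disj show False by blast
qed

end

theory Submission
  imports Defs
begin

text \<open>
  In a complementary pair of rates \<open>\<rho> = p\<alpha> + q\<close> and \<open>\<sigma> = s\<alpha> + t\<close> the densities satisfy
  \<open>1/\<rho> + 1/\<sigma> = 1\<close>, that is \<open>(\<rho> - 1)(\<sigma> - 1) = 1\<close>. Hence \<open>\<rho> - 1\<close> and \<open>\<sigma> - 1\<close> are mutually inverse
  units \<open>x \<plusminus> y\<surd>8\<close> of \<open>\<int>[\<surd>8]\<close>. As \<open>\<lfloor>n\<surd>8\<rfloor>\<close> has increments 2 and 3, monotonicity of the slower sequence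
  forces \<open>x \<ge> 3\<bar>y\<bar>\<close>, which together with \<open>x\<^sup>2 - 8y\<^sup>2 = 1\<close> leaves only \<open>3 \<plusminus> \<surd>8\<close>. The constant terms
  are settled by the first few values, and Beatty's theorem applies to the remaining pair, since
  \<open>4n - \<lfloor>n\<surd>8\<rfloor> - 1 = \<lfloor>n(4 - \<surd>8)\<rfloor>\<close>.
\<close>

section \<open>Densities of complementary sequences\<close>

text \<open>Since \<open>f\<close> stays within \<open>C\<close> of the line of slope \<rho>, the
  indices with value at most \<open>N\<close> contain all n \<le> (N - C)/\<rho> and none beyond (N
  + C)/\<rho>, so their number is N/\<rho> up to a constant independent of \<open>N\<close>.\<close>

lemma card_le_linear_growth:
  fixes f :: "nat \<Rightarrow> int" and \<rho> C :: real
  assumes \<rho>: "0 < \<rho>" and C: "\<And>n. \<bar>of_int (f n) - \<rho> * real n\<bar> \<le> C"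
  shows "finite {n. 1 \<le> n \<and> f n \<le> int N}"
    and "\<bar>real (card {n. 1 \<le> n \<and> f n \<le> int N}) - real N / \<rho>\<bar> \<le> C / \<rho> + 1"
proof -
  let ?A = "{n. 1 \<le> n \<and> f n \<le> int N}"
  \<comment> \<open>If N < C, then \<open>?l\<close> is truncated to 0 and \<open>{1..?l}\<close> is
    empty.\<close>
  let ?h = "nat \<lfloor>(real N + C) / \<rho>\<rfloor>" and ?l = "nat \<lfloor>(real N - C) / \<rho>\<rfloor>"
  have C0: "0 \<le> C" using C[of 0] by linarith
  have up: "?A \<subseteq> {1..?h}"
  proof
    fix n assume "n \<in> ?A"
    then have n: "1 \<le> n" and "of_int (f n) \<le> real N" by auto
    then have "\<rho> * real n \<le> real N + C" using C[of n] by linarith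
    then have "real n \<le> (real N + C) / \<rho>" using \<rho> by (simp add: field_simps)
    then have "n \<le> ?h" by (simp add: le_nat_floor)
    then show "n \<in> {1..?h}" using n by simp
  qed
  show fin: "finite ?A" using up finite_subset by blast
  have lo: "{1..?l} \<subseteq> ?A"
  proof
    fix n assume n: "n \<in> {1..?l}"
    then have "int n \<le> \<lfloor>(real N - C) / \<rho>\<rfloor>" by auto
    then have "real n \<le> (real N - C) / \<rho>" by (simp add: le_floor_iff)
    then have "\<rho> * real n \<le> real N - C" using \<rho> by (simp add: field_simps)
    then have "of_int (f n) \<le> real N" using C[of n] by linarith
    then have "f n \<le> int N" by linarith
    then show "n \<in> ?A" using n by simp
  qed
  have "card ?A \<le> ?h" using card_mono[OF _ up] by simp
  moreover have "0 \<le> (real N + C) / \<rho>" using C0 \<rho> by simp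
  ultimately have 1: "real (card ?A) \<le> (real N + C) / \<rho>"
    by (meson of_nat_floor of_nat_le_iff order_trans)
  have "?l \<le> card ?A" using card_mono[OF fin lo] by simp
  then have 2: "(real N - C) / \<rho> - 1 \<le> real (card ?A)" by linarith
  show "\<bar>real (card ?A) - real N / \<rho>\<bar> \<le> C / \<rho> + 1"
    using 1 2 by (simp add: add_divide_distrib diff_divide_distrib abs_le_iff)
qed

text \<open>Each of 1, ..., N is hit exactly once, so N = N/\<rho> + N/\<sigma> up to an error
  bounded independently of N; letting N grow removes the error.\<close>

lemma complementary_density:
  fixes V W :: "nat \<Rightarrow> int" and \<rho> \<sigma> C D :: real
  assumes comp: "complementary V W" and inj: "inj_on V {1..}" "inj_on W {1..}"
    and pos: "0 < \<rho>" "0 < \<sigma>"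
    and C: "\<And>n. \<bar>of_int (V n) - \<rho> * real n\<bar> \<le> C"
    and D: "\<And>n. \<bar>of_int (W n) - \<sigma> * real n\<bar> \<le> D"
  shows "1 / \<rho> + 1 / \<sigma> = 1"
proof -
  \<comment> \<open>\<open>K\<close> is the sum of the two counting errors C/\<rho> + 1 and
    D/\<sigma> + 1.\<close>
  define K where "K = C / \<rho> + D / \<sigma> + 2"
  define e where "e = 1 - 1 / \<rho> - 1 / \<sigma>"
  have bound: "real N * \<bar>e\<bar> \<le> K" for N
  proof -
    let ?A = "{n. 1 \<le> n \<and> V n \<le> int N}" and ?B = "{n. 1 \<le> n \<and> W n \<le> int N}"
    note A = card_le_linear_growth[OF pos(1) C, of N]
    note B = card_le_linear_growth[OF pos(2) D, of N]
    have disj: "V ` {1..} \<inter> W ` {1..} = {}" and un: "V ` {1..} \<union> W ` {1..} = {k. 0 < k}"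
      using comp by (auto simp: complementary_def)
    have "V ` ?A \<union> W ` ?B = (V ` {1..} \<union> W ` {1..}) \<inter> {..int N}" by auto
    also have "\<dots> = {1..int N}" unfolding un by auto
    finally have "card (V ` ?A \<union> W ` ?B) = N" by simp
    moreover have "V ` ?A \<inter> W ` ?B = {}" using disj by blast
    ultimately have "card (V ` ?A) + card (W ` ?B) = N"
      using A(1) B(1) by (simp add: card_Un_disjoint)
    moreover have "card (V ` ?A) = card ?A" "card (W ` ?B) = card ?B"
      by (auto intro!: card_image intro: inj_on_subset[OF inj(1)] inj_on_subset[OF inj(2)])
    ultimately have "real (card ?A) + real (card ?B) = real N"
      by (metis of_nat_add)
    then have "\<bar>real N - real N / \<rho> - real N / \<sigma>\<bar> \<le> K"
      using A(2) B(2) unfolding K_def by linarith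
    moreover have "real N - real N / \<rho> - real N / \<sigma> = real N * e"
      by (simp add: e_def algebra_simps)
    ultimately show ?thesis by (simp add: abs_mult)
  qed
  have "e = 0"
  proof (rule ccontr)
    assume "e \<noteq> 0"
    then obtain N :: nat where "K < real N * \<bar>e\<bar>"
      using reals_Archimedean3[of "\<bar>e\<bar>"] by auto
    then show False using bound[of N] by simp
  qed
  then show ?thesis by (simp add: e_def)
qed

text \<open>Replacing the floor by n\<alpha> costs only \<open>p\<close> times a fractional
  part.\<close>

lemma gen_beatty_linear_growth:
  "\<bar>of_int (gen_beatty \<alpha> p q r n) - (of_int p * \<alpha> + of_int q) * real n\<bar>
     \<le> \<bar>of_int p\<bar> + \<bar>of_int r\<bar>"
proof -
  have "of_int (gen_beatty \<alpha> p q r n) - (of_int p * \<alpha> + of_int q) * real n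
      = of_int r - of_int p * frac (real n * \<alpha>)"
    by (simp add: gen_beatty_def frac_def algebra_simps)
  also have "\<bar>\<dots>\<bar> \<le> \<bar>of_int r\<bar> + \<bar>of_int p\<bar> * frac (real n * \<alpha>)"
    by (metis abs_mult abs_of_nonneg abs_triangle_ineq4 frac_ge_0)
  also have "\<dots> \<le> \<bar>of_int r\<bar> + \<bar>of_int p\<bar> * 1"
    by (intro add_left_mono mult_left_mono) (simp_all add: frac_lt_1 less_imp_le)
  finally show ?thesis by simp
qed

section \<open>Beatty's theorem\<close>

lemma irrational_mult_nat_neq_int:
  fixes a :: real
  assumes "a \<notin> \<rat>" "0 < n"
  shows "real n * a \<noteq> of_int k"
proof
  assume "real n * a = of_int k"
  then have "a = of_int k / real n" using assms(2) by (simp add: field_simps)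
  then show False using assms(1) by simp
qed

text \<open>A common value k would force an integer strictly between k and k + 1; a missed value k
  would itself lie strictly between consecutive integers n + m and n + m + 1.\<close>

lemma Beatty:
  fixes a b :: real
  assumes irr: "a \<notin> \<rat>" "b \<notin> \<rat>" and gt: "1 < a" "1 < b" and ab: "1 / a + 1 / b = 1"
  shows "complementary (\<lambda>n. \<lfloor>real n * a\<rfloor>) (\<lambda>n. \<lfloor>real n * b\<rfloor>)"
proof -
  \<comment> \<open>The floor gives k/c \<le> n < (k + 1)/c; irrationality of \<open>c\<close> makes
    the left inequality strict.\<close>
  have lt: "of_int k / c < real n" "real n < (of_int k + 1) / c"
    if "\<lfloor>real n * c\<rfloor> = k" "1 \<le> n" "c \<notin> \<rat>" "1 < c" for k n and c :: real
  proof -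
    have "of_int k \<le> real n * c" "real n * c < of_int k + 1" using that(1) by linarith+
    moreover have "real n * c \<noteq> of_int k"
      using irrational_mult_nat_neq_int that(2,3) by simp
    ultimately show "of_int k / c < real n" "real n < (of_int k + 1) / c"
      using that(4) by (simp_all add: field_simps)
  qed
  \<comment> \<open>If no multiple of \<open>c\<close> falls into [k, k + 1), then k/c and (k + 1)/c
    lie in the same open interval between consecutive integers; its left end \<open>n\<close> may be
    0.\<close>
  have gap: "\<exists>n::nat. real n < of_int k / c \<and> (of_int k + 1) / c < real n + 1"
    if k: "0 < k" and c: "c \<notin> \<rat>" "1 < c" and no: "k \<notin> (\<lambda>n. \<lfloor>real n * c\<rfloor>) ` {1..}"
    for k :: int and c :: real
  proof -
    define n where "n = nat \<lfloor>of_int k / c\<rfloor>"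
    have "0 \<le> of_int k / c" using k c(2) by simp
    then have n: "real n \<le> of_int k / c" "of_int k / c < real n + 1"
      unfolding n_def by linarith+
    have "real n * c \<noteq> of_int k"
      using irrational_mult_nat_neq_int[OF c(1), of n k] k by (cases "n = 0") auto
    then have 1: "real n < of_int k / c" using n(1) c(2) by (auto simp: field_simps)
    have "k \<noteq> \<lfloor>real (Suc n) * c\<rfloor>" using no by (metis atLeast_iff image_eqI le_add1 plus_1_eq_Suc)
    moreover have "of_int k < real (Suc n) * c" using n(2) c(2) by (simp add: field_simps)
    ultimately have "of_int k + 1 \<le> real (Suc n) * c" by linarith
    moreover have "real (Suc n) * c \<noteq> of_int (k + 1)"
      by (rule irrational_mult_nat_neq_int[OF c(1)]) simp
    ultimately have "(of_int k + 1) / c < real n + 1" using c(2) by (simp add: field_simps)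
    then show ?thesis using 1 by blast
  qed
  \<comment> \<open>Adding the estimates for \<open>a\<close> and \<open>b\<close> thus turns the
    fractional bounds into integers.\<close>
  have split: "x / a + x / b = x" for x
    using ab by (metis distrib_left mult.right_neutral times_divide_eq_right)
  have "\<lfloor>real n * a\<rfloor> \<noteq> \<lfloor>real m * b\<rfloor>" if "1 \<le> n" "1 \<le> m" for n m
  proof
    define k where "k = \<lfloor>real n * a\<rfloor>"
    assume "\<lfloor>real n * a\<rfloor> = \<lfloor>real m * b\<rfloor>"
    then have "real_of_int k < of_int (int n + int m)" "real_of_int (int n + int m) < of_int (k + 1)"
      using lt[of n a k] lt[of m b k] that irr gt split[of "of_int k"] split[of "of_int k + 1"]
      by (auto simp: k_def)
    then show False unfolding of_int_less_iff by linarith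
  qed
  moreover have "0 < \<lfloor>real n * c\<rfloor>" if "1 \<le> n" "1 < c" for n and c :: real
    using that mult_mono[of 1 "real n" 1 c] by simp
  moreover have "k \<in> (\<lambda>n. \<lfloor>real n * a\<rfloor>) ` {1..} \<union> (\<lambda>n. \<lfloor>real n * b\<rfloor>) ` {1..}"
    if k: "0 < k" for k
  proof (rule ccontr)
    assume "\<not> ?thesis"
    then obtain n m :: nat where
      "real n < of_int k / a" "(of_int k + 1) / a < real n + 1"
      "real m < of_int k / b" "(of_int k + 1) / b < real m + 1"
      using gap[OF k irr(1) gt(1)] gap[OF k irr(2) gt(2)] by blast
    then have "real_of_int (int n + int m) < of_int k"
      "real_of_int (k + 1) < of_int (int n + int m + 2)"
      using split[of "of_int k"] split[of "of_int k + 1"] by simp_all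
    then show False unfolding of_int_less_iff by linarith
  qed
  ultimately show ?thesis using gt unfolding complementary_def by fastforce
qed

lemma strict_mono_on_floor_mult:
  fixes a :: real
  assumes "1 \<le> a"
  shows "strict_mono_on S (\<lambda>n. \<lfloor>real n * a\<rfloor>)"
proof (rule strict_mono_onI)
  fix m n :: nat assume "m < n"
  then have "real m + 1 \<le> real n" by simp
  then have "(real m + 1) * a \<le> real n * a" using assms by (intro mult_right_mono) auto
  then have "real m * a + 1 \<le> real n * a" using assms by (simp add: algebra_simps)
  then show "\<lfloor>real m * a\<rfloor> < \<lfloor>real n * a\<rfloor>" by linarith
qed

section \<open>The case of the square root of 8\<close>

lemma sqrt8_bounds: "2.82 < sqrt 8" "sqrt 8 < 2.83"
  by (rule real_less_rsqrt, simp add: power2_eq_square)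
     (rule real_less_lsqrt, simp_all add: power2_eq_square)

lemma sqrt8_irrational: "sqrt 8 \<notin> \<rat>"
proof
  assume "sqrt 8 \<in> \<rat>"
  then obtain m n :: nat where n: "n \<noteq> 0" and mn: "\<bar>sqrt 8\<bar> = real m / real n" and "coprime m n"
    by (rule Rats_abs_nat_div_natE)
  then have "real m = sqrt 8 * real n" by (simp add: field_simps)
  then have "(real m)\<^sup>2 = 8 * (real n)\<^sup>2" by (simp add: power_mult_distrib)
  then have eq: "m\<^sup>2 = 8 * n\<^sup>2" by (metis of_nat_eq_iff of_nat_mult of_nat_numeral of_nat_power)
  then have "even (m\<^sup>2)" by simp
  then have "even m" by simp
  then obtain k where k: "m = 2 * k" by blast
  then have "k\<^sup>2 = 2 * n\<^sup>2" using eq by (simp add: power_mult_distrib)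
  then have "even (k\<^sup>2)" by simp
  then have "even k" by simp
  then obtain j where "k = 2 * j" by blast
  with \<open>k\<^sup>2 = 2 * n\<^sup>2\<close> have "n\<^sup>2 = 2 * j\<^sup>2" by (simp add: power_mult_distrib)
  then have "even (n\<^sup>2)" by simp
  then have "even n" by simp
  with \<open>even m\<close> \<open>coprime m n\<close> show False by (metis coprime_common_divisor odd_one)
qed

section \<open>Uniqueness of the increasing solution\<close>

lemma sqrt8_lin_indep:
  fixes x y :: int
  assumes "of_int x + of_int y * sqrt 8 = 0"
  shows "x = 0" "y = 0"
proof -
  show "y = 0"
  proof (rule ccontr)
    assume "y \<noteq> 0"
    then have "sqrt 8 = of_int (- x) / of_int y" using assms by (simp add: field_simps)
    then show False using sqrt8_irrational by (metis Rats_divide Rats_of_int)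
  qed
  then show "x = 0" using assms by simp
qed

text \<open>The floors rise by 3 up to index 5 and first rise by 2 from index 5 to 6, so six values
  show both increments.\<close>

lemma gen_beatty_sqrt8_values:
  "gen_beatty (sqrt 8) p q r 1 = 2 * p + q + r"
  "gen_beatty (sqrt 8) p q r 2 = 5 * p + 2 * q + r"
  "gen_beatty (sqrt 8) p q r 3 = 8 * p + 3 * q + r"
  "gen_beatty (sqrt 8) p q r 4 = 11 * p + 4 * q + r"
  "gen_beatty (sqrt 8) p q r 5 = 14 * p + 5 * q + r"
  "gen_beatty (sqrt 8) p q r 6 = 16 * p + 6 * q + r"
proof -
  have "\<lfloor>sqrt 8\<rfloor> = 2" "\<lfloor>2 * sqrt 8\<rfloor> = 5" "\<lfloor>3 * sqrt 8\<rfloor> = 8" "\<lfloor>4 * sqrt 8\<rfloor> = 11"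
    "\<lfloor>5 * sqrt 8\<rfloor> = 14" "\<lfloor>6 * sqrt 8\<rfloor> = 16"
    using sqrt8_bounds by (auto simp: floor_eq_iff)
  then show "gen_beatty (sqrt 8) p q r 1 = 2 * p + q + r"
    "gen_beatty (sqrt 8) p q r 2 = 5 * p + 2 * q + r"
    "gen_beatty (sqrt 8) p q r 3 = 8 * p + 3 * q + r"
    "gen_beatty (sqrt 8) p q r 4 = 11 * p + 4 * q + r"
    "gen_beatty (sqrt 8) p q r 5 = 14 * p + 5 * q + r"
    "gen_beatty (sqrt 8) p q r 6 = 16 * p + 6 * q + r"
    by (simp_all add: gen_beatty_def)
qed

text \<open>The increments from 1 to 2 and from 5 to 6 are q + 3p and q + 2p. The rate lies between
  them because 2 < sqrt 8 < 3; the sign of \<open>p\<close> decides which one bounds it from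
  below.\<close>

lemma strict_mono_gen_beatty_sqrt8:
  assumes "strict_mono_on {1..} (gen_beatty (sqrt 8) p q r)"
  shows "1 \<le> q + 2 * p" "1 \<le> q + 3 * p" "1 \<le> of_int p * sqrt 8 + of_int q"
proof -
  have "gen_beatty (sqrt 8) p q r 1 < gen_beatty (sqrt 8) p q r 2"
    "gen_beatty (sqrt 8) p q r 5 < gen_beatty (sqrt 8) p q r 6"
    using assms by (auto intro: strict_mono_onD)
  then show 1: "1 \<le> q + 2 * p" "1 \<le> q + 3 * p" unfolding gen_beatty_sqrt8_values by auto
  show "1 \<le> of_int p * sqrt 8 + of_int q"
  proof (cases "0 \<le> p")
    case True
    then have "of_int p * 2 \<le> of_int p * sqrt 8" using sqrt8_bounds by (intro mult_left_mono) auto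
    then show ?thesis using 1(1) by linarith
  next
    case False
    then have "of_int p * 3 \<le> of_int p * sqrt 8"
      using sqrt8_bounds by (intro mult_left_mono_neg) auto
    then show ?thesis using 1(2) by linarith
  qed
qed

text \<open>\<open>prod\<close> and \<open>conj\<close> are the rational and irrational parts of (a
  + p sqrt 8)(b + s sqrt 8) = 1.\<close>

lemma inverse_units_sqrt8:
  fixes p a s b :: int
  assumes prod: "a * b + 8 * p * s = 1" and conj: "p * b + s * a = 0" and nz: "p \<noteq> 0"
    and bounds: "0 \<le> a + 3 * p" "0 \<le> b + 3 * s"
  shows "a = 3 \<and> b = 3 \<and> (p = 1 \<and> s = -1 \<or> p = -1 \<and> s = 1)"
proof -
  \<comment> \<open>Multiply \<open>prod\<close> by \<open>p\<close> or by \<open>s\<close> and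
    eliminate with \<open>conj\<close>.\<close>
  have "s * (8 * p\<^sup>2 - a\<^sup>2) = p" "p * (8 * s\<^sup>2 - b\<^sup>2) = s"
    using prod conj by algebra+
  then have "s dvd p" "p dvd s" by (metis dvd_triv_left)+
  then have "\<bar>p\<bar> = \<bar>s\<bar>" by (intro zdvd_antisym_abs)
  then have "s = p \<or> s = - p" by linarith
  \<comment> \<open>This case would give norm a^2 - 8p^2 = -1, but a square is never 3 modulo
    4.\<close>
  moreover have "s \<noteq> p"
  proof
    assume s: "s = p"
    then have "p * (b + a) = 0" using conj by (simp add: algebra_simps)
    then have "b = - a" using nz by simp
    then have "a * a = 8 * (p * p) - 1" using s prod by simp
    then have "a * a mod 4 = 3" by presburger
    moreover have "a * a mod 4 = (a mod 4) * (a mod 4) mod 4" by (simp add: mod_mult_eq)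
    moreover have "a mod 4 \<in> {0, 1, 2, 3}" by auto
    ultimately show False by auto
  qed
  ultimately have s: "s = - p" by simp
  then have "p * (b - a) = 0" using conj by (simp add: algebra_simps)
  then have b: "b = a" using nz by simp
  have pell: "a * a = 8 * (p * p) + 1" using prod s b by simp
  \<comment> \<open>With b = a and s = -p the bounds read a + 3p \<ge> 0 and a - 3p \<ge> 0.
    Squaring gives 9p^2 \<le> a^2 = 8p^2 + 1.\<close>
  have "3 * \<bar>p\<bar> \<le> a" using bounds s b by simp
  then have "(3 * \<bar>p\<bar>) * (3 * \<bar>p\<bar>) \<le> a * a" by (intro mult_mono) auto
  then have "p * p \<le> 1" using pell by simp
  then have "\<bar>p\<bar> \<le> 1" by (metis abs_le_square_iff abs_one one_power2 power2_eq_square)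
  then have p: "p = 1 \<or> p = -1" using nz by linarith
  then have "a * a = 3 * 3" using pell by auto
  then have "a = 3" using \<open>3 * \<bar>p\<bar> \<le> a\<close> by (simp only: square_eq_iff) auto
  then show ?thesis using p s b by auto
qed

lemma increasing_solution_sqrt8_coeffs:
  assumes sol: "increasing_solution (sqrt 8) p q r s t u" and nz: "p \<noteq> 0"
  shows "q = 4 \<and> t = 4 \<and> (p = 1 \<and> s = -1 \<or> p = -1 \<and> s = 1)"
proof -
  define \<rho> \<sigma> where "\<rho> = of_int p * sqrt 8 + of_int q" and "\<sigma> = of_int s * sqrt 8 + of_int t"
  have mono: "strict_mono_on {1..} (gen_beatty (sqrt 8) p q r)"
    "strict_mono_on {1..} (gen_beatty (sqrt 8) s t u)"
    using sol by (auto simp: increasing_solution_def)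
  note V = strict_mono_gen_beatty_sqrt8[OF mono(1)] and W = strict_mono_gen_beatty_sqrt8[OF mono(2)]
  have pos: "0 < \<rho>" "0 < \<sigma>" using V(3) W(3) by (simp_all add: \<rho>_def \<sigma>_def)
  have "1 / \<rho> + 1 / \<sigma> = 1"
    using sol pos gen_beatty_linear_growth[of "sqrt 8" p q r] gen_beatty_linear_growth[of "sqrt 8" s t u]
    unfolding increasing_solution_def cpp_solution_def \<rho>_def \<sigma>_def
    by (intro complementary_density) auto
  then have "\<rho> + \<sigma> = \<rho> * \<sigma>" using pos by (simp add: field_simps)
  then have "(\<rho> - 1) * (\<sigma> - 1) - 1 = 0" by (simp add: algebra_simps)
  also have "(\<rho> - 1) * (\<sigma> - 1) - 1
      = of_int ((q - 1) * (t - 1)) + of_int (p * s) * (sqrt 8 * sqrt 8) - 1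
        + of_int (p * (t - 1) + s * (q - 1)) * sqrt 8"
    by (simp add: \<rho>_def \<sigma>_def algebra_simps)
  also have "\<dots> = of_int ((q - 1) * (t - 1) + 8 * p * s - 1)
        + of_int (p * (t - 1) + s * (q - 1)) * sqrt 8"
    by simp
  finally have "(q - 1) * (t - 1) + 8 * p * s - 1 = 0" "p * (t - 1) + s * (q - 1) = 0"
    by (rule sqrt8_lin_indep)+
  \<comment> \<open>The increments q + 3p and t + 3s are at least 1, which supplies the bounds for a
    = q - 1 and b = t - 1.\<close>
  then show ?thesis using inverse_units_sqrt8[of "q - 1" "t - 1" p s] nz V(2) W(2) by auto
qed

text \<open>V(1) = 1 fixes \<open>r\<close>; then \<open>u\<close> is fixed because W(1) must be the
  least positive integer that V misses.\<close>

lemma increasing_solution_sqrt8_unique: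
  assumes sol: "increasing_solution (sqrt 8) p q r s t u" and nz: "p \<noteq> 0"
  shows "(p, q, r, s, t, u) = (-1, 4, -1, 1, 4, 0)"
proof -
  let ?V = "gen_beatty (sqrt 8) p q r" and ?W = "gen_beatty (sqrt 8) s t u"
  have V1: "?V 1 = 1" and monoV: "strict_mono_on {1..} ?V" and monoW: "strict_mono_on {1..} ?W"
    and disj: "?V ` {1..} \<inter> ?W ` {1..} = {}" and un: "?V ` {1..} \<union> ?W ` {1..} = {k. 0 < k}"
    using sol by (auto simp: increasing_solution_def cpp_solution_def complementary_def)
  have neq: "?V m \<noteq> ?W n" if "1 \<le> m" "1 \<le> n" for m n
    using disj that by (metis IntI atLeast_iff emptyE image_eqI)
  have geV: "?V m \<le> ?V n" and geW: "?W m \<le> ?W n" if "1 \<le> m" "m \<le> n" for m n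
    using monoV monoW that by (auto simp: strict_mono_on_leD)
  have posW: "0 < ?W 1" using un by (metis UnCI atLeast_iff image_eqI mem_Collect_eq order_refl)
  from increasing_solution_sqrt8_coeffs[OF sol nz]
  consider "p = 1" "q = 4" "s = -1" "t = 4" | "p = -1" "q = 4" "s = 1" "t = 4" by auto
  then show ?thesis
  proof cases
    case 1
    then have r: "r = -5" using V1 unfolding gen_beatty_sqrt8_values by simp
    \<comment> \<open>Here V starts 1, 8, so W has to start with 2.\<close>
    have "2 \<in> ?V ` {1..} \<union> ?W ` {1..}" unfolding un by simp
    then obtain n where n: "1 \<le> n" "?V n = 2 \<or> ?W n = 2" by auto
    have "?V n \<noteq> 2"
      using geV[of 2 n] n(1) V1 gen_beatty_sqrt8_values(2)[of p q r] 1 r by (cases "n = 1") auto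
    then have "?W 1 \<le> 2" using n geW[of 1 n] by auto
    moreover have "?W 1 \<noteq> 1" using neq[of 1 1] V1 by simp
    ultimately have "u = 0" using posW 1 unfolding gen_beatty_sqrt8_values by simp
    \<comment> \<open>Both values are 8, so this sign choice is impossible.\<close>
    then have "?V 2 = ?W 6" unfolding gen_beatty_sqrt8_values using 1 r by simp
    then show ?thesis using neq[of 2 6] by simp
  next
    case 2
    then have r: "r = -1" using V1 unfolding gen_beatty_sqrt8_values by simp
    have V: "?V 1 = 1" "?V 2 = 2" "?V 3 = 3" "?V 4 = 4" "?V 5 = 5" "?V 6 = 7"
      unfolding gen_beatty_sqrt8_values using 2 r by simp_all
    \<comment> \<open>V jumps from 5 to 7, so 6 is the first value of W.\<close>
    have "6 \<in> ?V ` {1..} \<union> ?W ` {1..}" unfolding un by simp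
    then obtain n where n: "1 \<le> n" "?V n = 6 \<or> ?W n = 6" by auto
    have "?V n \<noteq> 6"
      using geV[of 6 n] geV[of n 5] n(1) V by (cases "n \<le> 5") auto
    then have "?W 1 \<le> 6" using n geW[of 1 n] by auto
    moreover have "?W 1 \<noteq> 1" "?W 1 \<noteq> 2" "?W 1 \<noteq> 3" "?W 1 \<noteq> 4" "?W 1 \<noteq> 5"
      using neq[of 1 1] neq[of 2 1] neq[of 3 1] neq[of 4 1] neq[of 5 1] V by auto
    ultimately have "?W 1 = 6" using posW by linarith
    then have "u = 0" using 2 unfolding gen_beatty_sqrt8_values by simp
    then show ?thesis using 2 r by simp
  qed
qed

section \<open>Existence, by Beatty's theorem for 4 - sqrt 8 and 4 + sqrt 8\<close>

lemma increasing_solution_sqrt8: "increasing_solution (sqrt 8) (-1) 4 (-1) 1 4 0"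
proof -
  let ?a = "4 - sqrt 8" and ?b = "4 + sqrt 8"
  let ?V = "gen_beatty (sqrt 8) (-1) 4 (-1)" and ?W = "gen_beatty (sqrt 8) 1 4 0"
  \<comment> \<open>For non-integral x the floor of -x is -\<lfloor>x\<rfloor> - 1, whence r = -1.
    At n = 0 the two sides differ: -1 against 0.\<close>
  have V: "?V n = \<lfloor>real n * ?a\<rfloor>" if "n \<in> {1..}" for n
  proof -
    have "real n * sqrt 8 \<noteq> of_int \<lfloor>real n * sqrt 8\<rfloor>"
      using that by (intro irrational_mult_nat_neq_int sqrt8_irrational) simp
    then have "\<lfloor>4 * real n - real n * sqrt 8\<rfloor> = 4 * int n - \<lfloor>real n * sqrt 8\<rfloor> - 1" by linarith
    then show ?thesis by (simp add: gen_beatty_def algebra_simps)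
  qed
  have W: "?W n = \<lfloor>real n * ?b\<rfloor>" for n
  proof -
    have "\<lfloor>4 * real n + real n * sqrt 8\<rfloor> = 4 * int n + \<lfloor>real n * sqrt 8\<rfloor>" by linarith
    then show ?thesis by (simp add: gen_beatty_def algebra_simps)
  qed
  have irr: "?a \<notin> \<rat>" "?b \<notin> \<rat>"
    using sqrt8_irrational Rats_diff[of 4 ?a] Rats_diff[of ?b 4] by auto
  have gt: "1 < ?a" "1 < ?b" using sqrt8_bounds by auto
  \<comment> \<open>The sum of the two numbers is 8 as well, so their reciprocals add up to
    1.\<close>
  have "?a * ?b = 8" by (simp add: algebra_simps)
  then have "1 / ?a + 1 / ?b = 1" using gt by (simp add: field_simps)
  note comp = Beatty[OF irr gt this]
  have imgV: "?V ` {1..} = (\<lambda>n. \<lfloor>real n * ?a\<rfloor>) ` {1..}" using V by (rule image_cong[OF refl])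
  have imgW: "?W ` {1..} = (\<lambda>n. \<lfloor>real n * ?b\<rfloor>) ` {1..}" using W by simp
  have monoV: "strict_mono_on {1..} ?V"
    using strict_mono_on_floor_mult[of ?a "{1..}"] gt V by (simp add: strict_mono_on_def)
  have monoW: "strict_mono_on {1..} ?W"
    using strict_mono_on_floor_mult[of ?b "{1..}"] gt W by (simp add: strict_mono_on_def)
  have "complementary ?V ?W" using comp by (simp only: complementary_def imgV imgW)
  then show ?thesis
    using monoV monoW gen_beatty_sqrt8_values(1)[of "-1" 4 "-1"]
    by (simp add: increasing_solution_def cpp_solution_def strict_mono_on_imp_inj_on)
qed

theorem theorem13:
  "{(p, q, r, s, t, u). increasing_solution (sqrt 8) p q r s t u \<and>
      \<not> trivial_solution (sqrt 8) p q r s t u} = {(-1, 4, -1, 1, 4, 0)}"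
proof (intro equalityI subsetI)
  fix x assume "x \<in> {(p, q, r, s, t, u). increasing_solution (sqrt 8) p q r s t u \<and>
      \<not> trivial_solution (sqrt 8) p q r s t u}"
  then obtain p q r s t u where x: "x = (p, q, r, s, t, u)"
    and sol: "increasing_solution (sqrt 8) p q r s t u"
    and nontriv: "\<not> trivial_solution (sqrt 8) p q r s t u"
    by blast
  have "p \<noteq> 0"
    using sol nontriv by (simp add: increasing_solution_def trivial_solution_def)
  then show "x \<in> {(-1, 4, -1, 1, 4, 0)}"
    using increasing_solution_sqrt8_unique[OF sol] x by simp
next
  fix x :: "int \<times> int \<times> int \<times> int \<times> int \<times> int" assume "x \<in> {(-1, 4, -1, 1, 4, 0)}"
  then show "x \<in> {(p, q, r, s, t, u). increasing_solution (sqrt 8) p q r s t u \<and>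
      \<not> trivial_solution (sqrt 8) p q r s t u}"
    using increasing_solution_sqrt8 by (simp add: trivial_solution_def)
qed

end
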